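(* If a $(K,M,N)$ secure coded caching scheme can be realized by a $(K,F,Z,S)$ SPDA, with $\frac{M}{N}=\frac{F+Z}{2F}$, then its transmission rate $R=\frac{S}{F}$ satisfies $$R=\frac{S}{F}\ \ge\ \frac12\cdot\frac{K}{1+\frac{Z}{F}+2K\frac{Z}{F}}\left(1-\frac{Z}{F}\right).$$
   Context: For a positive integer $n$, $[0,n)=\{0,1,\dots,n-1\}$. For positive integers $K,F$, an $F\times K$ array $\mathbf{P}=(p_{j,k})_{j\in[0,F),k\in[0,K)}$ with entries in $\{*\}\cup[0,S)$ is a $(K,F,Z,S)$ secure placement delivery array (SPDA) if: (C1) the symbol $*$ appears exactly $Z$ times in each column; (C2) each $s\in[0,S)$ appears at least four times; (C3) for each $s\in[0,S)$, the subarray $\mathbf{P}^{(s)}$ formed by all rows and columns containing $s$ is, up to row and column permutations, a $(g+1)\times g$ array (for some $g$ depending on $s$) whose first row has all entries equal to $s$ and whose remaining $g$ rows form the $g\times g$ array with $s$ on the diagonal and $*$ off the diagonal. A $(K,M,N)$ scheme serves $K$ users, each with a cache of size $M$ files, from a server holding $N$ files. The scheme realized by a $(K,F,Z,S)$ SPDA splits each file into $F$ equal packets; user $k$ caches, for every file, the packets of the rows $j$ with $p_{j,k}=*$ together with the packets of the rows $j^{(s)}$ with $p_{j^{(s)},k}=s$, where $j^{(s)}$ is the unique row containing $s$ at least twice (so $\frac{M}{N}=\frac{F+Z}{2F}$). In the delivery phase the server broadcasts exactly one encrypted signal of the size of one packet for each $s\in[0,S)$. The transmission rate (number of broadcast bits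 divided by the file size) is therefore $R=S/F$; the theorem is a bound on this quantity valid for every SPDA. *)

theory Defs
  imports Complex_Main
begin

text \<open>An \<open>F \<times> K\<close> array is a function \<open>P\<close> of row \<open>j < F\<close> and column \<open>k < K\<close>;
  \<open>None\<close> stands for the symbol \<open>*\<close>.\<close>

type_synonym array = "nat \<Rightarrow> nat \<Rightarrow> nat option"

definition rows_with :: "nat \<Rightarrow> nat \<Rightarrow> array \<Rightarrow> nat \<Rightarrow> nat set" where
  "rows_with K F P s = {j. j < F \<and> (\<exists>k<K. P j k = Some s)}"

definition cols_with :: "nat \<Rightarrow> nat \<Rightarrow> array \<Rightarrow> nat \<Rightarrow> nat set" where
  "cols_with K F P s = {k. k < K \<and> (\<exists>j<F. P j k = Some s)}"

text \<open>In the last condition the bijections \<open>\<rho>\<close> and \<open>\<gamma>\<close> are the row and column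
  permutations: they list the rows and columns of the subarray in the order in which it
  has the required form.\<close>

definition spda :: "nat \<Rightarrow> nat \<Rightarrow> nat \<Rightarrow> nat \<Rightarrow> array \<Rightarrow> bool" where
  "spda K F Z S P \<longleftrightarrow>
     K > 0 \<and> F > 0 \<and>
     (\<forall>j<F. \<forall>k<K. \<forall>s. P j k = Some s \<longrightarrow> s < S) \<and>
     (\<forall>k<K. card {j. j < F \<and> P j k = None} = Z) \<and>
     (\<forall>s<S. card {(j, k). j < F \<and> k < K \<and> P j k = Some s} \<ge> 4) \<and>
     (\<forall>s<S. \<exists>g \<rho> \<gamma>.
        bij_betw \<rho> {..<Suc g} (rows_with K F P s) \<and>
        bij_betw \<gamma> {..<g} (cols_with K F P s) \<and>
        (\<forall>b<g. P (\<rho> 0) (\<gamma> b) = Some s) \<and>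
        (\<forall>a<g. \<forall>b<g. P (\<rho> (Suc a)) (\<gamma> b) = (if a = b then Some s else None)))"

text \<open>A scheme records the sizes and index sets on which memory and rate depend; the bit
  contents of caches and signals are left out. The packet \<open>(n, j)\<close> is packet \<open>j\<close> of
  file \<open>n\<close>, and \<open>memory\<close> is measured in files.\<close>

record caching_scheme =
  num_users :: nat
  memory :: real
  num_files :: nat
  num_packets :: nat
  packet_bits :: nat
  cache :: "nat \<Rightarrow> (nat \<times> nat) set"
  signals :: "nat set"
  signal_bits :: "nat \<Rightarrow> nat"

definition file_bits :: "caching_scheme \<Rightarrow> nat" where
  "file_bits C = num_packets C * packet_bits C"

definition is_scheme :: "nat \<Rightarrow> real \<Rightarrow> nat \<Rightarrow> caching_scheme \<Rightarrow> bool" where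
  "is_scheme K M N C \<longleftrightarrow>
     num_users C = K \<and> memory C = M \<and> num_files C = N \<and>
     K > 0 \<and> N > 0 \<and> num_packets C > 0 \<and> packet_bits C > 0 \<and> finite (signals C) \<and>
     (\<forall>k<K. cache C k \<subseteq> {..<N} \<times> {..<num_packets C} \<and>
            real (card (cache C k) * packet_bits C) \<le> M * real (file_bits C))"

definition transmission_rate :: "caching_scheme \<Rightarrow> real" where
  "transmission_rate C = real (\<Sum>s\<in>signals C. signal_bits C s) / real (file_bits C)"

text \<open>In an SPDA the following description has exactly one solution for every \<open>s < S\<close>.\<close>

definition repeated_row :: "nat \<Rightarrow> nat \<Rightarrow> array \<Rightarrow> nat \<Rightarrow> nat" where
  "repeated_row K F P s = (THE j. j < F \<and> card {k. k < K \<and> P j k = Some s} \<ge> 2)"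

definition cached_rows :: "nat \<Rightarrow> nat \<Rightarrow> array \<Rightarrow> nat \<Rightarrow> nat set" where
  "cached_rows K F P k =
     {j. j < F \<and> (P j k = None \<or> (\<exists>s. P j k = Some s \<and> j = repeated_row K F P s))}"

definition realized_by :: "caching_scheme \<Rightarrow> nat \<Rightarrow> nat \<Rightarrow> nat \<Rightarrow> nat \<Rightarrow> array \<Rightarrow> bool" where
  "realized_by C K F Z S P \<longleftrightarrow>
     spda K F Z S P \<and>
     num_users C = K \<and> num_packets C = F \<and>
     (\<forall>k<K. cache C k = {..<num_files C} \<times> cached_rows K F P k) \<and>
     signals C = {..<S} \<and>
     (\<forall>s<S. signal_bits C s = packet_bits C)"

end

theory Submission
  imports Defs "HOL-Analysis.Convex"
begin

text \<open>Let \<open>g\<^sub>s\<close> be the number of columns containing \<open>s\<close>, so that half of the \<open>K (F - Z)\<close>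
  entries give \<open>\<Sum>\<^sub>s g\<^sub>s = K (F - Z) / 2\<close>. Each of the \<open>g\<^sub>s\<close> rows below the first one of
  \<open>P\<^sup>(\<^sup>s\<^sup>)\<close> contains at least \<open>g\<^sub>s - 1\<close> stars. If \<open>z\<^sub>j\<close> is the number of stars in row \<open>j\<close> and
  \<open>d\<^sub>j\<close> the number of symbols \<open>s\<close> for which \<open>j\<close> is such a row, then \<open>d\<^sub>j + z\<^sub>j \<le> K\<close> and
  \<open>\<Sum>\<^sub>s g\<^sub>s\<^sup>2 \<le> \<Sum>\<^sub>j d\<^sub>j (1 + z\<^sub>j) \<le> \<Sum>\<^sub>s g\<^sub>s + \<Sum>\<^sub>j z\<^sub>j (K - z\<^sub>j)\<close>. Cauchy-Schwarz on both
  \<open>\<Sum>\<^sub>s g\<^sub>s\<^sup>2\<close> and \<open>\<Sum>\<^sub>j z\<^sub>j\<^sup>2\<close>, with \<open>\<Sum>\<^sub>j z\<^sub>j = K Z\<close>, gives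
  \<open>K F (F - Z) \<le> 2 S (F + 2 K Z)\<close>, which is slightly stronger than the claim.\<close>

definition row_stars :: "nat \<Rightarrow> array \<Rightarrow> nat \<Rightarrow> nat" where
  "row_stars K P j = card {k. k < K \<and> P j k = None}"

text \<open>This strips the permutations from condition (C3) and keeps what the counting uses.
  \<open>D\<close> consists of the rows of the subarray below its constant first row, so its
  cardinality is the number \<open>g\<close> of columns.\<close>

lemma spda_symbol_rows:
  assumes "spda K F Z S P" "s < S"
  obtains D where "D \<subseteq> {..<F}"
    and "card {(j, k). j < F \<and> k < K \<and> P j k = Some s} \<le> 2 * card D"
    and "\<And>j. j \<in> D \<Longrightarrow> \<exists>k<K. P j k = Some s"
    and "\<And>j. j \<in> D \<Longrightarrow> card D \<le> 1 + row_stars K P j"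
proof -
  obtain g \<rho> \<gamma> where \<rho>: "bij_betw \<rho> {..<Suc g} (rows_with K F P s)"
    and \<gamma>: "bij_betw \<gamma> {..<g} (cols_with K F P s)"
    and diag: "\<And>a b. a < g \<Longrightarrow> b < g \<Longrightarrow> P (\<rho> (Suc a)) (\<gamma> b) = (if a = b then Some s else None)"
    using assms unfolding spda_def by (elim conjE allE[where x = s]) blast
  define D where "D = (\<rho> \<circ> Suc) ` {..<g}"
  have row: "\<rho> a < F" if "a < Suc g" for a
    using bij_betwE[OF \<rho>] that by (auto simp: rows_with_def)
  have col: "\<gamma> b < K" if "b < g" for b
    using bij_betwE[OF \<gamma>] that by (auto simp: cols_with_def)
  have inj\<gamma>: "inj_on \<gamma> {..<g}" using \<gamma> by (rule bij_betw_imp_inj_on)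
  have "inj_on (\<rho> \<circ> Suc) {..<g}"
    using bij_betw_imp_inj_on[OF \<rho>] by (auto simp: inj_on_def)
  then have card_D: "card D = g" unfolding D_def by (subst card_image) auto
  \<comment> \<open>An occurrence of \<open>s\<close> lies either in row \<open>\<rho> 0\<close> or,
    as the remaining block has stars off its diagonal, on that diagonal. Each of the two families
    has at most \<open>g\<close> cells.\<close>
  have "{(j, k). j < F \<and> k < K \<and> P j k = Some s}
      \<subseteq> (\<lambda>b. (\<rho> 0, \<gamma> b)) ` {..<g} \<union> (\<lambda>b. (\<rho> (Suc b), \<gamma> b)) ` {..<g}"
  proof clarify
    fix j k assume jk: "j < F" "k < K" "P j k = Some s"
      and no: "(j, k) \<notin> (\<lambda>b. (\<rho> (Suc b), \<gamma> b)) ` {..<g}"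
    have "j \<in> \<rho> ` {..<Suc g}" "k \<in> \<gamma> ` {..<g}"
      using jk bij_betw_imp_surj_on[OF \<rho>] bij_betw_imp_surj_on[OF \<gamma>]
      by (auto simp: rows_with_def cols_with_def)
    then obtain a b where ab: "a < Suc g" "j = \<rho> a" "b < g" "k = \<gamma> b" by auto
    have "a = 0"
    proof (cases a)
      case (Suc c)
      then show ?thesis using ab jk no diag[of c b] by (auto split: if_splits)
    qed
    then show "(j, k) \<in> (\<lambda>b. (\<rho> 0, \<gamma> b)) ` {..<g}" using ab by auto
  qed
  then have "card {(j, k). j < F \<and> k < K \<and> P j k = Some s}
      \<le> card ((\<lambda>b. (\<rho> 0, \<gamma> b)) ` {..<g} \<union> (\<lambda>b. (\<rho> (Suc b), \<gamma> b)) ` {..<g})"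
    by (intro card_mono) auto
  also have "\<dots> \<le> card ((\<lambda>b. (\<rho> 0, \<gamma> b)) ` {..<g}) + card ((\<lambda>b. (\<rho> (Suc b), \<gamma> b)) ` {..<g})"
    by (rule card_Un_le)
  also have "\<dots> \<le> g + g"
    by (intro add_mono card_image_le[THEN order_trans]) auto
  finally have cells: "card {(j, k). j < F \<and> k < K \<and> P j k = Some s} \<le> 2 * card D"
    by (simp add: card_D)
  have "card D \<le> 1 + row_stars K P j" if j: "j \<in> D" for j
  proof -
    obtain a where a: "a < g" "j = \<rho> (Suc a)" using j by (auto simp: D_def)
    \<comment> \<open>The off-diagonal entries of row \<open>a\<close> of the block are stars in
      \<open>g - 1\<close> distinct columns.\<close>
    have "\<gamma> ` ({..<g} - {a}) \<subseteq> {k. k < K \<and> P j k = None}"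
      using a diag col by auto
    then have "card (\<gamma> ` ({..<g} - {a})) \<le> row_stars K P j"
      unfolding row_stars_def by (intro card_mono) auto
    moreover have "card (\<gamma> ` ({..<g} - {a})) = g - 1"
      using a inj_on_subset[OF inj\<gamma>, of "{..<g} - {a}"] by (simp add: card_image)
    ultimately show ?thesis by (simp add: card_D)
  qed
  moreover have "D \<subseteq> {..<F}" using row by (auto simp: D_def)
  moreover have "\<exists>k<K. P j k = Some s" if "j \<in> D" for j
    using that diag col by (fastforce simp: D_def)
  ultimately show ?thesis using that cells by blast
qed

lemma sum_row_stars:
  assumes "spda K F Z S P"
  shows "(\<Sum>j<F. row_stars K P j) = K * Z"
proof -
  have "(\<Sum>j<F. row_stars K P j) = (\<Sum>j<F. \<Sum>k<K. if P j k = None then 1 else 0)"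
    by (intro sum.cong) (auto simp: row_stars_def sum.If_cases lessThan_def Collect_conj_eq)
  also have "\<dots> = (\<Sum>k<K. \<Sum>j<F. if P j k = None then 1 else 0)"
    by (rule sum.swap)
  also have "\<dots> = (\<Sum>k<K. card {j. j < F \<and> P j k = None})"
    by (intro sum.cong) (auto simp: sum.If_cases lessThan_def Collect_conj_eq)
  also have "\<dots> = K * Z"
    using assms by (simp add: spda_def)
  finally show ?thesis .
qed

text \<open>The star cells and the symbol classes cover the array, so union bounds suffice. The
  additive form avoids truncated subtraction in \<open>F - Z\<close>.\<close>

lemma spda_card_entries:
  assumes "spda K F Z S P"
  shows "K * F \<le> K * Z + (\<Sum>s<S. card {(j, k). j < F \<and> k < K \<and> P j k = Some s})"
proof -
  let ?N = "SIGMA j:{..<F}. {k. k < K \<and> P j k = None}"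
  let ?E = "\<lambda>s. {(j, k). j < F \<and> k < K \<and> P j k = Some s}"
  have fin: "finite (?E s)" for s
    by (rule finite_subset[of _ "{..<F} \<times> {..<K}"]) auto
  have bounded: "s < S" if "j < F" "k < K" "P j k = Some s" for j k s
    using assms that unfolding spda_def by blast
  have "{..<F} \<times> {..<K} \<subseteq> ?N \<union> (\<Union>s<S. ?E s)"
  proof (rule subrelI)
    fix j k assume "(j, k) \<in> {..<F} \<times> {..<K}"
    then show "(j, k) \<in> ?N \<union> (\<Union>s<S. ?E s)" using bounded by (cases "P j k") auto
  qed
  then have "card ({..<F} \<times> {..<K}) \<le> card (?N \<union> (\<Union>s<S. ?E s))"
    using fin by (intro card_mono) auto
  also have "\<dots> \<le> card ?N + card (\<Union>s<S. ?E s)"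
    by (rule card_Un_le)
  also have "\<dots> \<le> K * Z + (\<Sum>s<S. card (?E s))"
    using sum_row_stars[OF assms] by (intro add_mono card_UN_le) (auto simp: row_stars_def)
  finally show ?thesis by (simp add: mult.commute)
qed

lemma spda_bound:
  assumes P: "spda K F Z S P"
  shows "real K * F * (real F - Z) \<le> 2 * real S * (real F + 2 * real K * Z)"
proof -
  define z where "z j = real (row_stars K P j)" for j
  \<comment> \<open>Keeping \<open>s < S\<close> inside the existential lets the axiom of choice
    deliver one total function \<open>D\<close>.\<close>
  have "\<forall>s. \<exists>D. s < S \<longrightarrow> D \<subseteq> {..<F} \<and>
      card {(j, k). j < F \<and> k < K \<and> P j k = Some s} \<le> 2 * card D \<and>
      (\<forall>j\<in>D. \<exists>k<K. P j k = Some s) \<and> (\<forall>j\<in>D. card D \<le> 1 + row_stars K P j)"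
    (is "\<forall>s. \<exists>D. ?Q s D")
  proof
    fix s
    show "\<exists>D. ?Q s D"
    proof (cases "s < S")
      case True
      show ?thesis by (rule spda_symbol_rows[OF P True]) blast
    qed simp
  qed
  then obtain D where D: "\<forall>s. ?Q s (D s)"
    by (rule choice[THEN exE])
  have sub: "D s \<subseteq> {..<F}"
    and cells: "card {(j, k). j < F \<and> k < K \<and> P j k = Some s} \<le> 2 * card (D s)"
    and ex: "\<forall>j\<in>D s. \<exists>k<K. P j k = Some s"
    and stars: "\<forall>j\<in>D s. card (D s) \<le> 1 + row_stars K P j"
    if "s < S" for s
    using D[rule_format, OF that] by auto
  define d where "d j = real (card {s. s < S \<and> j \<in> D s})" for j
  define G where "G = (\<Sum>s<S. real (card (D s)))"
  have z_sum: "(\<Sum>j<F. z j) = real K * Z"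
    unfolding z_def using sum_row_stars[OF P] by (metis of_nat_mult of_nat_sum)
  have "K * F \<le> K * Z + (\<Sum>s<S. 2 * card (D s))"
    using spda_card_entries[OF P] sum_mono[of "{..<S}", OF cells] by fastforce
  then have "real (K * F) \<le> real (K * Z + (\<Sum>s<S. 2 * card (D s)))"
    by (simp only: of_nat_le_iff)
  then have G_ge: "real K * (real F - Z) \<le> 2 * G"
    by (simp add: G_def sum_distrib_left algebra_simps)
  \<comment> \<open>Each symbol counted by \<open>d j\<close> gets a column where it occurs in row
    \<open>j\<close>. A cell holds only one symbol, so these columns are distinct, and none of them
    carries a star in row \<open>j\<close>.\<close>
  have d_le: "d j \<le> K - z j" for j
  proof -
    have "\<forall>s\<in>{s. s < S \<and> j \<in> D s}. \<exists>k. k < K \<and> P j k = Some s" using ex by blast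
    then obtain f where f: "\<forall>s\<in>{s. s < S \<and> j \<in> D s}. f s < K \<and> P j (f s) = Some s"
      by metis
    have "inj_on f {s. s < S \<and> j \<in> D s}" by (rule inj_onI) (metis f option.inject)
    moreover have "f ` {s. s < S \<and> j \<in> D s} \<subseteq> {k. k < K \<and> P j k \<noteq> None}" using f by auto
    ultimately have "card {s. s < S \<and> j \<in> D s} \<le> card {k. k < K \<and> P j k \<noteq> None}"
      by (intro card_inj_on_le) auto
    moreover have "card {k. k < K \<and> P j k \<noteq> None} + row_stars K P j
        = card ({k. k < K \<and> P j k \<noteq> None} \<union> {k. k < K \<and> P j k = None})"
      unfolding row_stars_def by (subst card_Un_disjoint) auto
    moreover have "{k. k < K \<and> P j k \<noteq> None} \<union> {k. k < K \<and> P j k = None} = {..<K}" by auto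
    ultimately have "card {s. s < S \<and> j \<in> D s} + row_stars K P j \<le> K" by simp
    then show ?thesis by (simp add: d_def z_def)
  qed
  \<comment> \<open>Double counting of the pairs of a symbol \<open>s\<close> and a row
    \<open>j\<close> in \<open>D s\<close>, with weight \<open>h j\<close>.\<close>
  have swap: "(\<Sum>s<S. \<Sum>j\<in>D s. h j) = (\<Sum>j<F. d j * h j)" for h :: "nat \<Rightarrow> real"
  proof -
    have "(\<Sum>s<S. \<Sum>j\<in>D s. h j) = (\<Sum>s<S. \<Sum>j | j \<in> {..<F} \<and> j \<in> D s. h j)"
      using sub by (intro sum.cong) auto
    also have "\<dots> = (\<Sum>j<F. \<Sum>s | s \<in> {..<S} \<and> j \<in> D s. h j)"
      by (rule sum.swap_restrict) auto
    finally show ?thesis by (simp add: d_def)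
  qed
  \<comment> \<open>The square is the constant \<open>card (D s)\<close> summed over
    \<open>D s\<close>, and each summand is at most \<open>1 + z j\<close>.\<close>
  have "(\<Sum>s<S. (real (card (D s)))\<^sup>2) \<le> (\<Sum>s<S. \<Sum>j\<in>D s. 1 + z j)"
  proof (rule sum_mono)
    fix s assume "s \<in> {..<S}"
    then have "(\<Sum>j\<in>D s. real (card (D s))) \<le> (\<Sum>j\<in>D s. 1 + z j)"
      using stars[of s] by (intro sum_mono) (fastforce simp: z_def)
    then show "(real (card (D s)))\<^sup>2 \<le> (\<Sum>j\<in>D s. 1 + z j)"
      by (simp add: power2_eq_square)
  qed
  also have "\<dots> = G + (\<Sum>j<F. d j * z j)"
    using swap[of z] by (simp add: sum.distrib G_def)
  also have "(\<Sum>j<F. d j * z j) \<le> (\<Sum>j<F. (K - z j) * z j)"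
    using d_le by (intro sum_mono mult_right_mono) (auto simp: z_def)
  also have "\<dots> = K * (real K * Z) - (\<Sum>j<F. (z j)\<^sup>2)"
    by (simp add: algebra_simps sum_subtractf sum_distrib_left[symmetric] z_sum power2_eq_square)
  finally have sq: "(\<Sum>s<S. (real (card (D s)))\<^sup>2) \<le> G + (K * (real K * Z) - (\<Sum>j<F. (z j)\<^sup>2))"
    by simp
  \<comment> \<open>Cauchy-Schwarz against the all-ones vector on the \<open>F\<close> rows.\<close>
  have "(real K * Z)\<^sup>2 \<le> real F * (\<Sum>j<F. (z j)\<^sup>2)"
    using sum_squared_le_sum_of_squares[of z "{..<F}"] by (simp add: z_sum mult.commute)
  moreover have "F * (\<Sum>s<S. (real (card (D s)))\<^sup>2)
      \<le> F * G + F * (K * (real K * Z)) - F * (\<Sum>j<F. (z j)\<^sup>2)"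
    using mult_left_mono[OF sq, of "real F"] by (simp add: algebra_simps)
  ultimately have "F * (\<Sum>s<S. (real (card (D s)))\<^sup>2) \<le> F * G + real K * Z * (K * (real F - Z))"
    by (simp add: power2_eq_square algebra_simps)
  \<comment> \<open>Replacing \<open>K * (F - Z)\<close> by \<open>2 * G\<close> leaves a factor
    \<open>G\<close> in every term, which cancels against the \<open>G\<^sup>2\<close> of the second
    Cauchy-Schwarz estimate.\<close>
  also have "\<dots> \<le> F * G + real K * Z * (2 * G)"
    using G_ge by (intro add_left_mono mult_left_mono) auto
  finally have sq': "F * (\<Sum>s<S. (real (card (D s)))\<^sup>2) \<le> G * (real F + 2 * real K * Z)"
    by (simp add: algebra_simps)
  have "G\<^sup>2 \<le> S * (\<Sum>s<S. (real (card (D s)))\<^sup>2)"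
    using sum_squared_le_sum_of_squares[of "\<lambda>s. real (card (D s))" "{..<S}"]
    by (simp add: G_def mult.commute)
  then have "F * G\<^sup>2 \<le> S * (F * (\<Sum>s<S. (real (card (D s)))\<^sup>2))"
    using mult_left_mono[of "G\<^sup>2" _ "real F"] by (simp add: mult.left_commute)
  also have "\<dots> \<le> S * (G * (real F + 2 * real K * Z))"
    using sq' by (intro mult_left_mono) auto
  finally have main: "G * (F * G) \<le> G * (S * (real F + 2 * real K * Z))"
    by (simp add: power2_eq_square mult.left_commute mult.assoc)
  have "G \<ge> 0" by (simp add: G_def sum_nonneg)
  \<comment> \<open>For \<open>G = 0\<close> nothing can be cancelled, but then the left side is 0
    and the right side is nonnegative.\<close>
  then have "F * G \<le> S * (real F + 2 * real K * Z)"
    using main by (cases "G = 0") auto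
  moreover have "F * (real K * (real F - Z)) \<le> F * (2 * G)"
    using G_ge by (intro mult_left_mono) auto
  ultimately show ?thesis by (simp add: algebra_simps)
qed

theorem theorem2:
  fixes K F Z S N :: nat and M :: real and C :: caching_scheme and P :: array
  assumes "is_scheme K M N C"
    and "realized_by C K F Z S P"
    and "M / real N = (real F + real Z) / (2 * real F)"
  shows "transmission_rate C = real S / real F \<and>
         real S / real F \<ge>
           1 / 2 * (real K / (1 + real Z / real F + 2 * real K * (real Z / real F)))
             * (1 - real Z / real F)"
proof
  have P: "spda K F Z S P" using assms(2) by (simp add: realized_by_def)
  then have F: "real F > 0" by (simp add: spda_def)
  show "transmission_rate C = real S / real F"
    using assms(1,2)
    by (simp add: transmission_rate_def file_bits_def is_scheme_def realized_by_def)
  have "real K * F * (real F - Z) \<le> 2 * real S * (real F + 2 * real K * Z)"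
    by (rule spda_bound[OF P])
  \<comment> \<open>The extra \<open>Z\<close> weakens the bound to the stated denominator, here
    multiplied by \<open>F\<close>.\<close>
  also have "\<dots> \<le> 2 * real S * (real F + Z + 2 * real K * Z)"
    by (intro mult_left_mono) auto
  finally have bound: "real K * F * (real F - Z) \<le> 2 * real S * (real F + Z + 2 * real K * Z)" .
  have pos: "real F + Z + 2 * real K * Z > 0" using F by (simp add: add_pos_nonneg)
  have "1 + real Z / F + 2 * real K * (real Z / F) = (real F + Z + 2 * real K * Z) / F"
    and "1 - real Z / F = (real F - Z) / F"
    using F by (simp_all add: field_simps)
  then have "1 / 2 * (real K / (1 + real Z / F + 2 * real K * (real Z / F))) * (1 - real Z / F)
      = real K * (real F - Z) / (2 * (real F + Z + 2 * real K * Z))"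
    using F by simp
  also have "\<dots> \<le> S / real F"
    using bound F pos by (simp add: field_simps)
  finally show "real S / real F \<ge>
      1 / 2 * (real K / (1 + real Z / real F + 2 * real K * (real Z / real F)))
        * (1 - real Z / real F)" .
qed

end
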